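(* Consider the hereditary maximin share problem with $n\ge 1$ agents and a hereditary set system $H=(J,\mathcal{F})$ on a finite set $J$ of $m$ items, as described in the context, and assume ${\tt MMS}(i)>0$ for every agent $i$. Run the Fair Division Procedure (described in the context) with target value $\alpha=\frac{1}{3}$. Then, for every choice of the maximin partitions used in the normalization and for every choice of the pairs $(S,i)$ made during the procedure, every agent $i$ is allocated a bundle $S_i$, and $v_i(S_i)\ge \frac13\cdot {\tt MMS}(i)$.
   Context: A hereditary set system $H=(J,\mathcal{F})$ consists of a finite set $J$ of items and a nonempty family $\mathcal{F}$ of subsets of $J$ (the feasible or independent sets) such that $S\in\mathcal{F}$ and $T\subseteq S$ imply $T\in\mathcal{F}$. There is a set $I$ of $n$ agents; agent $i$ has a nonnegative value $v_{i,j}$ for each item $j$, and for any $S\subseteq J$ its value is $v_i(S)=\max_{T\in\mathcal{F},\,T\subseteq S}\sum_{j\in T}v_{i,j}$ (so $v_i(S)=\sum_{j\in S}v_{i,j}$ when $S\in\mathcal{F}$). Let $\mathbb{P}$ be the set of partitions of $J$ into $n$ (possibly empty) parts. The maximin share of agent $i$ is ${\tt MMS}(i)=\max_{\mathcal{P}\in\mathbb{P}}\min_{P\in\mathcal{P}}v_i(P)$, and a partition attaining it is a maximin partition for $i$. Fair Division Procedure with target $\alpha$: (1) Normalization: for each agent $i$ fix a maximin partition $\mathcal{P}_i$; for an item $j$ lying in part $P\in\mathcal{P}_i$ set $\hat v_{i,j}=v_{i,j}/v_i(P)$, and define $\hat v_i(S)=\max_{T\in\mathcal{F},T\subseteq S}\sum_{j\in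 T}\hat v_{i,j}$. (2) Let $I$ be the set of all agents and $J$ the set of all items. For $\tau=1,2,\dots,m$: while there exist a set $S\subseteq J$ with $|S|=\tau$ and an agent $i\in I$ with $\hat v_i(S)\ge\alpha$, choose any such pair, allocate bundle $S$ to agent $i$, and set $I\leftarrow I\setminus\{i\}$, $J\leftarrow J\setminus S$. *)

theory Defs
  imports Complex_Main "HOL-Library.Disjoint_Sets"
begin

definition hereditary_system :: "'a set \<Rightarrow> 'a set set \<Rightarrow> bool" where
  "hereditary_system J F \<longleftrightarrow>
     finite J \<and> F \<noteq> {} \<and> F \<subseteq> Pow J \<and> (\<forall>S\<in>F. \<forall>T. T \<subseteq> S \<longrightarrow> T \<in> F)"

definition set_value :: "'a set set \<Rightarrow> ('a \<Rightarrow> real) \<Rightarrow> 'a set \<Rightarrow> real" where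
  "set_value F w S = Max {sum w T | T. T \<in> F \<and> T \<subseteq> S}"

text \<open>The parts of a partition are indexed by \<open>{..<n}\<close>, so that several of them may be empty
  (which \<^const>\<open>partition_on\<close> would not allow).\<close>

definition partitions_into :: "nat \<Rightarrow> 'a set \<Rightarrow> (nat \<Rightarrow> 'a set) set" where
  "partitions_into n J = {P. disjoint_family_on P {..<n} \<and> (\<Union>k<n. P k) = J}"

definition min_part_value :: "'a set set \<Rightarrow> ('a \<Rightarrow> real) \<Rightarrow> nat \<Rightarrow> (nat \<Rightarrow> 'a set) \<Rightarrow> real" where
  "min_part_value F w n P = Min ((\<lambda>k. set_value F w (P k)) ` {..<n})"

definition MMS :: "'a set \<Rightarrow> 'a set set \<Rightarrow> nat \<Rightarrow> ('a \<Rightarrow> real) \<Rightarrow> real" where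
  "MMS J F n w = Max (min_part_value F w n ` partitions_into n J)"

definition maximin_partition ::
    "'a set \<Rightarrow> 'a set set \<Rightarrow> nat \<Rightarrow> ('a \<Rightarrow> real) \<Rightarrow> (nat \<Rightarrow> 'a set) \<Rightarrow> bool" where
  "maximin_partition J F n w P \<longleftrightarrow>
     P \<in> partitions_into n J \<and> min_part_value F w n P = MMS J F n w"

text \<open>For an item outside all parts the normalized value is unspecified; it is never used, since
  feasible sets consist of items of the partitioned set.\<close>

definition normalized ::
    "'a set set \<Rightarrow> nat \<Rightarrow> ('a \<Rightarrow> real) \<Rightarrow> (nat \<Rightarrow> 'a set) \<Rightarrow> 'a \<Rightarrow> real" where
  "normalized F n w P j = w j / set_value F w (P (THE k. k < n \<and> j \<in> P k))"

text \<open>A state consists of the counter \<open>\<tau>\<close>, the remaining agents, the remaining items and the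
  bundles allocated so far.\<close>

type_synonym ('i, 'a) fdp_state = "nat \<times> 'i set \<times> 'a set \<times> ('i \<rightharpoonup> 'a set)"

text \<open>Below, \<open>w i\<close> holds the normalized item values of agent \<open>i\<close>, and \<open>m\<close> is the initial number
  of items. The loop at \<open>\<tau>\<close> is left only when no eligible pair is left.\<close>

definition eligible ::
    "'a set set \<Rightarrow> ('i \<Rightarrow> 'a \<Rightarrow> real) \<Rightarrow> real \<Rightarrow> nat \<Rightarrow> 'i set \<Rightarrow> 'a set \<Rightarrow> 'a set \<Rightarrow> 'i \<Rightarrow> bool" where
  "eligible F w \<alpha> \<tau> I J S i \<longleftrightarrow>
     S \<subseteq> J \<and> card S = \<tau> \<and> i \<in> I \<and> set_value F (w i) S \<ge> \<alpha>"

inductive fdp_step ::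
    "'a set set \<Rightarrow> ('i \<Rightarrow> 'a \<Rightarrow> real) \<Rightarrow> real \<Rightarrow> nat \<Rightarrow>
     ('i, 'a) fdp_state \<Rightarrow> ('i, 'a) fdp_state \<Rightarrow> bool"
  for F w \<alpha> m where
  allocate: "\<tau> \<le> m \<Longrightarrow> eligible F w \<alpha> \<tau> I J S i \<Longrightarrow>
     fdp_step F w \<alpha> m (\<tau>, I, J, A) (\<tau>, I - {i}, J - S, A(i \<mapsto> S))"
| advance: "\<tau> \<le> m \<Longrightarrow> \<nexists>S i. eligible F w \<alpha> \<tau> I J S i \<Longrightarrow>
     fdp_step F w \<alpha> m (\<tau>, I, J, A) (Suc \<tau>, I, J, A)"

definition fdp_outcome ::
    "'i set \<Rightarrow> 'a set \<Rightarrow> 'a set set \<Rightarrow> ('i \<Rightarrow> 'a \<Rightarrow> real) \<Rightarrow> real \<Rightarrow> ('i \<rightharpoonup> 'a set) \<Rightarrow> bool" where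
  "fdp_outcome I J F w \<alpha> A \<longleftrightarrow>
     (\<exists>I' J'. (fdp_step F w \<alpha> (card J))\<^sup>*\<^sup>*
        (1, I, J, Map.empty) (Suc (card J), I', J', A))"

text \<open>Quantifying over outcomes covers all runs: there is no infinite run, and a run can be
  continued until the counter exceeds the number of items.\<close>

lemma wf_fdp_step:
  "wf {(t, s). finite (fst (snd s)) \<and> fdp_step F w \<alpha> m s t}"
proof (rule wf_subset[OF wf_measure])
  have "(Suc m - fst t) + card (fst (snd t)) < (Suc m - fst s) + card (fst (snd s))"
    if "fdp_step F w \<alpha> m s t" "finite (fst (snd s))" for s t
    using that
  proof cases
    case (allocate \<tau> I J S i A)
    then have "card (I - {i}) < card I"
      using that(2) by (intro card_Diff1_less) (auto simp: eligible_def)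
    then show ?thesis
      using allocate by simp
  next
    case (advance \<tau> I J A)
    then show ?thesis
      by simp
  qed
  then show "{(t, s). finite (fst (snd s)) \<and> fdp_step F w \<alpha> m s t}
      \<subseteq> measure (\<lambda>s. (Suc m - fst s) + card (fst (snd s)))"
    by auto
qed

lemma finite_agents_fdp_step:
  "fdp_step F w \<alpha> m s t \<Longrightarrow> finite (fst (snd s)) \<Longrightarrow> finite (fst (snd t))"
  by (auto elim!: fdp_step.cases)

lemma fdp_step_possible:
  "(\<exists>t. fdp_step F w \<alpha> m (\<tau>, I, J, A) t) \<longleftrightarrow> \<tau> \<le> m"
proof
  assume "\<exists>t. fdp_step F w \<alpha> m (\<tau>, I, J, A) t"
  then show "\<tau> \<le> m"
    by (auto elim: fdp_step.cases)
next
  assume "\<tau> \<le> m"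
  then show "\<exists>t. fdp_step F w \<alpha> m (\<tau>, I, J, A) t"
    using allocate[of \<tau> m F w \<alpha> I J _ _ A] advance[of \<tau> m F w \<alpha> I J A] by blast
qed

lemma fdp_completes:
  assumes "finite I" "\<tau> \<le> Suc m"
  shows "\<exists>I' J' A'. (fdp_step F w \<alpha> m)\<^sup>*\<^sup>* (\<tau>, I, J, A) (Suc m, I', J', A')"
proof -
  have "finite (fst (snd s)) \<Longrightarrow> fst s \<le> Suc m \<Longrightarrow>
      \<exists>I' J' A'. (fdp_step F w \<alpha> m)\<^sup>*\<^sup>* s (Suc m, I', J', A')" for s
  proof (induction s rule: wf_induct_rule[OF wf_fdp_step[of F w \<alpha> m]])
    case (1 s)
    show ?case
    proof (cases "fst s \<le> m")
      case True
      then obtain t where t: "fdp_step F w \<alpha> m s t"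
        using fdp_step_possible[of F w \<alpha> m "fst s" "fst (snd s)" "fst (snd (snd s))" "snd (snd (snd s))"]
        by auto
      moreover have "fst t \<le> Suc m"
        using t by (auto elim!: fdp_step.cases)
      ultimately show ?thesis
        using 1(1)[of t] 1(2) finite_agents_fdp_step[OF t]
        by (auto intro: converse_rtranclp_into_rtranclp)
    next
      case False
      then have "s = (Suc m, fst (snd s), fst (snd (snd s)), snd (snd (snd s)))"
        using 1 by (simp add: prod_eq_iff)
      then show ?thesis
        by (metis rtranclp.rtrancl_refl)
    qed
  qed
  from this[of "(\<tau>, I, J, A)"] show ?thesis
    using assms by simp
qed

lemma fdp_outcome_exists:
  "finite I \<Longrightarrow> \<exists>A. fdp_outcome I J F w \<alpha> A"
  unfolding fdp_outcome_def using fdp_completes[of I 1 "card J"] by fastforce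

end

theory Submission
  imports Defs
begin

text \<open>The same family \<open>F\<close> governs all agents, so a bundle \<open>S\<close> allocated at stage \<open>\<tau>\<close> is itself
  feasible: a proper subset realizing its value would have been allocated at an earlier stage.
  If \<open>\<tau> \<ge> 2\<close>, split \<open>S\<close> into one item and \<open>\<tau> - 1\<close> items. An agent that is still waiting
  values each piece below \<open>1/3\<close>, so \<open>S\<close> costs it less than \<open>2/3\<close> of additive value. If \<open>\<tau> = 1\<close>,
  then \<open>S\<close> meets only one part of the agent's maximin partition. In the end each part that no such
  singleton meets has lost more than \<open>2/3\<close> of its normalized value \<open>1\<close>, so an agent left without
  a bundle would require at least \<open>n\<close> bundles to have been allocated to the others.\<close>

section \<open>Feasible sets and set values\<close>

lemma hereditary_systemD:
  assumes "hereditary_system J F"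
  shows "finite J" "finite F" "{} \<in> F"
    "S \<in> F \<Longrightarrow> S \<subseteq> J" "S \<in> F \<Longrightarrow> T \<subseteq> S \<Longrightarrow> T \<in> F"
  using assms finite_subset[of F "Pow J"] by (auto simp: hereditary_system_def)

lemma sum_le_set_value:
  assumes "finite F" "T \<in> F" "T \<subseteq> S"
  shows "sum w T \<le> set_value F w S"
proof -
  have "finite {sum w T | T. T \<in> F \<and> T \<subseteq> S}"
    using assms(1) by simp
  then show ?thesis
    unfolding set_value_def using assms by (intro Max_ge) auto
qed

lemma set_value_attained:
  assumes "finite F" "{} \<in> F"
  obtains T where "T \<in> F" "T \<subseteq> S" "sum w T = set_value F w S"
proof -
  have "finite {sum w T | T. T \<in> F \<and> T \<subseteq> S}" "{sum w T | T. T \<in> F \<and> T \<subseteq> S} \<noteq> {}"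
    using assms by auto
  from Max_in[OF this] show thesis
    using that unfolding set_value_def by fastforce
qed

section \<open>Maximin partitions and normalized values\<close>

lemma maximin_partition_part_value:
  assumes "maximin_partition J F n w P" "k < n"
  shows "MMS J F n w \<le> set_value F w (P k)"
proof -
  have "min_part_value F w n P \<le> set_value F w (P k)"
    unfolding min_part_value_def using assms(2) by (intro Min_le) auto
  then show ?thesis
    using assms(1) by (simp add: maximin_partition_def)
qed

lemma normalized_in_part:
  assumes "P \<in> partitions_into n J" "k < n" "j \<in> P k"
  shows "normalized F n w P j = w j / set_value F w (P k)"
proof -
  have "(THE l. l < n \<and> j \<in> P l) = k"
    using assms unfolding partitions_into_def disjoint_family_on_def
    by (intro the_equality) blast+
  then show ?thesis
    by (simp add: normalized_def)
qed

lemma normalized_bounds: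
  assumes "maximin_partition J F n w P" "0 < MMS J F n w" "j \<in> J" "0 \<le> w j"
  shows "0 \<le> normalized F n w P j" "normalized F n w P j \<le> w j / MMS J F n w"
proof -
  have P: "P \<in> partitions_into n J"
    using assms(1) by (simp add: maximin_partition_def)
  obtain k where k: "k < n" "j \<in> P k"
    using P assms(3) by (auto simp: partitions_into_def)
  have "MMS J F n w \<le> set_value F w (P k)"
    using maximin_partition_part_value[OF assms(1) k(1)] .
  then show "0 \<le> normalized F n w P j" "normalized F n w P j \<le> w j / MMS J F n w"
    using assms(2,4) unfolding normalized_in_part[OF P k] by (auto intro: divide_left_mono)
qed

text \<open>All items of \<open>P k\<close> have the same positive divisor, the value of
  \<open>P k\<close>, so a feasible set realizing that value is scaled to exactly 1.\<close>

lemma normalized_part_attains_one: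
  assumes "hereditary_system J F" "maximin_partition J F n w P" "0 < MMS J F n w" "k < n"
  obtains Q where "Q \<in> F" "Q \<subseteq> P k" "sum (normalized F n w P) Q = 1"
proof -
  note H = hereditary_systemD[OF assms(1)]
  have P: "P \<in> partitions_into n J"
    using assms(2) by (simp add: maximin_partition_def)
  obtain Q where Q: "Q \<in> F" "Q \<subseteq> P k" "sum w Q = set_value F w (P k)"
    using set_value_attained[OF H(2,3)] .
  have "sum (normalized F n w P) Q = (\<Sum>j\<in>Q. w j / set_value F w (P k))"
    using Q(2) normalized_in_part[OF P assms(4)] by (intro sum.cong) auto
  also have "\<dots> = 1"
    using Q(3) maximin_partition_part_value[OF assms(2,4)] assms(3)
    by (simp flip: sum_divide_distrib)
  finally show thesis
    using that Q by blast
qed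

text \<open>The divisor of each item is the value of its part, hence at least the maximin share.
  This carries guarantees for normalized values back to \<open>w\<close>.\<close>

lemma normalized_set_value_le:
  assumes "hereditary_system J F" "maximin_partition J F n w P" "0 < MMS J F n w"
    and "\<And>j. j \<in> J \<Longrightarrow> 0 \<le> w j"
  shows "MMS J F n w * set_value F (normalized F n w P) S \<le> set_value F w S"
proof -
  note H = hereditary_systemD[OF assms(1)]
  obtain T where T: "T \<in> F" "T \<subseteq> S"
      "sum (normalized F n w P) T = set_value F (normalized F n w P) S"
    using set_value_attained[OF H(2,3)] .
  have "sum (normalized F n w P) T \<le> (\<Sum>j\<in>T. w j / MMS J F n w)"
    using T(1) H(4) normalized_bounds(2)[OF assms(2,3)] assms(4) by (intro sum_mono) blast
  also have "\<dots> = sum w T / MMS J F n w"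
    by (simp flip: sum_divide_distrib)
  finally have "MMS J F n w * sum (normalized F n w P) T \<le> sum w T"
    using assms(3) by (simp add: field_simps)
  also have "\<dots> \<le> set_value F w S"
    using sum_le_set_value[OF H(2) T(1,2)] .
  finally show ?thesis
    by (simp add: T(3))
qed

section \<open>The invariant of the procedure\<close>

text \<open>The last clause is the accounting from the point of view of a waiting agent \<open>i\<close>: \<open>X\<close> holds
  the items allocated as singletons, each charged \<open>2\<alpha>\<close> whatever its value.\<close>

definition fdp_invariant ::
    "'i set \<Rightarrow> 'a set \<Rightarrow> 'a set set \<Rightarrow> ('i \<Rightarrow> 'a \<Rightarrow> real) \<Rightarrow> real \<Rightarrow> ('i, 'a) fdp_state \<Rightarrow> bool" where
  "fdp_invariant I J F w \<alpha> = (\<lambda>(\<tau>, I', J', A).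
     1 \<le> \<tau> \<and> I' \<subseteq> I \<and> J' \<subseteq> J \<and>
     (\<forall>i\<in>I'. \<forall>S\<subseteq>J'. card S < \<tau> \<longrightarrow> set_value F (w i) S < \<alpha>) \<and>
     (\<forall>i\<in>I - I'. \<exists>S. A i = Some S \<and> set_value F (w i) S \<ge> \<alpha>) \<and>
     (\<forall>i\<in>I'. \<exists>X\<subseteq>J - J'.
        sum (w i) (J - J' - X) + 2 * \<alpha> * card X \<le> 2 * \<alpha> * (real (card I) - real (card I'))))"

text \<open>A feasible \<open>T\<close> inside \<open>S\<close> realizing the value of
  \<open>S\<close> is worth at least \<alpha> too; since smaller sets are worth less than \<alpha>,
  \<open>T\<close> must be all of \<open>S\<close>.\<close>

lemma eligible_feasible:
  assumes "hereditary_system J F" "J' \<subseteq> J" "eligible F w \<alpha> \<tau> I' J' S i"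
    and small: "\<And>T. T \<subseteq> J' \<Longrightarrow> card T < \<tau> \<Longrightarrow> set_value F (w i) T < \<alpha>"
  shows "S \<in> F"
proof -
  note H = hereditary_systemD[OF assms(1)]
  have S: "S \<subseteq> J'" "card S = \<tau>" "set_value F (w i) S \<ge> \<alpha>"
    using assms(3) by (auto simp: eligible_def)
  obtain T where T: "T \<in> F" "T \<subseteq> S" "sum (w i) T = set_value F (w i) S"
    using set_value_attained[OF H(2,3)] .
  have "set_value F (w i) T \<ge> \<alpha>"
    using sum_le_set_value[OF H(2) T(1), of T "w i"] T(3) S(3) by simp
  then have "\<not> card T < \<tau>"
    using small[of T] T(2) S(1) by fastforce
  moreover have "finite S"
    using S(1) assms(2) H(1) by (meson finite_subset)
  ultimately have "T = S"
    using T(2) S(2) psubset_card_mono by blast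
  then show ?thesis
    using T(1) by simp
qed

text \<open>Here \<open>w\<close> belongs to any waiting agent, not only to the one receiving
  \<open>S\<close>. As \<tau> is at least 2, both \<open>{a}\<close> and \<open>S - {a}\<close> have
  fewer than \<tau> items, and both are feasible by heredity, so their sums are bounded by their set
  values.\<close>

lemma sum_bundle_less:
  assumes "hereditary_system J F" "S \<in> F" "card S = \<tau>" "2 \<le> \<tau>"
    and small: "\<And>T. T \<subseteq> S \<Longrightarrow> card T < \<tau> \<Longrightarrow> set_value F w T < \<alpha>"
  shows "sum w S < 2 * \<alpha>"
proof -
  note H = hereditary_systemD[OF assms(1)]
  have fin: "finite S"
    using H(1,4) assms(2) finite_subset by blast
  obtain a where a: "a \<in> S"
    using assms(3,4) by fastforce
  have less: "sum w T < \<alpha>" if "T \<subseteq> S" "card T < \<tau>" for T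
    using sum_le_set_value[OF H(2) H(5)[OF assms(2) that(1)], of T w] small[OF that] by simp
  have "sum w {a} < \<alpha>" "sum w (S - {a}) < \<alpha>"
    using less[of "{a}"] less[of "S - {a}"] a fin assms(3,4) by auto
  then show ?thesis
    using sum.remove[OF fin a, of w] by simp
qed

lemma fdp_invariant_step:
  assumes H: "hereditary_system J F" and "finite I"
    and step: "fdp_step F w \<alpha> m s t" and inv: "fdp_invariant I J F w \<alpha> s"
  shows "fdp_invariant I J F w \<alpha> t"
  using step
proof cases
  case (advance \<tau> I' J' A)
  \<comment> \<open>Only sets of size exactly \<tau> are new in the smallness clause, and for these
    no eligible pair is left.\<close>
  then show ?thesis
    using inv unfolding fdp_invariant_def eligible_def
    by (fastforce simp: less_Suc_eq not_le)
next
  case (allocate \<tau> I' J' S i A)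
  have el: "S \<subseteq> J'" "card S = \<tau>" "i \<in> I'" "set_value F (w i) S \<ge> \<alpha>"
    using allocate(4) by (auto simp: eligible_def)
  have inv': "1 \<le> \<tau>" "I' \<subseteq> I" "J' \<subseteq> J"
      "\<And>i T. i \<in> I' \<Longrightarrow> T \<subseteq> J' \<Longrightarrow> card T < \<tau> \<Longrightarrow> set_value F (w i) T < \<alpha>"
      "\<And>i. i \<in> I - I' \<Longrightarrow> \<exists>S. A i = Some S \<and> set_value F (w i) S \<ge> \<alpha>"
      "\<And>i. i \<in> I' \<Longrightarrow> \<exists>X\<subseteq>J - J'. sum (w i) (J - J' - X) + 2 * \<alpha> * card X
         \<le> 2 * \<alpha> * (real (card I) - real (card I'))"
    using inv allocate(1) by (auto simp: fdp_invariant_def)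
  have finJ: "finite J"
    using hereditary_systemD(1)[OF H] .
  then have finS: "finite S"
    using el(1) inv'(3) by (meson finite_subset)
  have SF: "S \<in> F"
    using eligible_feasible[OF H inv'(3) allocate(4)] inv'(4)[OF el(3)] by blast
  have finI': "finite I'"
    using inv'(2) assms(2) by (rule finite_subset)
  have "card I' = Suc (card (I' - {i}))"
    using card.remove[OF finI' el(3)] .
  then have count: "real (card I) - real (card (I' - {i})) = real (card I) - real (card I') + 1"
    by simp
  have "\<exists>X\<subseteq>J - (J' - S). sum (w l) (J - (J' - S) - X) + 2 * \<alpha> * card X
         \<le> 2 * \<alpha> * (real (card I) - real (card (I' - {i})))" if l: "l \<in> I' - {i}" for l
  proof -
    obtain X where X: "X \<subseteq> J - J'"
        "sum (w l) (J - J' - X) + 2 * \<alpha> * card X \<le> 2 * \<alpha> * (real (card I) - real (card I'))"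
      using inv'(6)[of l] l by blast
    have finX: "finite X"
      using X(1) finJ by (meson finite_Diff finite_subset)
    show ?thesis
    proof (cases "\<tau> = 1")
      case True
      \<comment> \<open>The right-hand side grows by \<open>2 * \<alpha>\<close>, which pays for the
        new element of \<open>X \<union> S\<close>. Smallness below size 1 says nothing about the
        value of a single item to \<open>l\<close>, so that value is kept out of the sum.\<close>
      have "J - (J' - S) - (X \<union> S) = J - J' - X"
        using el(1) by blast
      moreover have "card (X \<union> S) = card X + 1"
        using X(1) el(1,2) True finX finS by (subst card_Un_disjoint) auto
      ultimately show ?thesis
        using X el(1) inv'(3) unfolding count
        by (intro exI[of _ "X \<union> S"]) (auto simp: algebra_simps)
    next
      case False
      \<comment> \<open>Now \<open>X\<close> stays the same, and the growth of the right-hand side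
        pays for the additive value of \<open>S\<close> to \<open>l\<close>.\<close>
      have "J - (J' - S) - X = (J - J' - X) \<union> S" "(J - J' - X) \<inter> S = {}"
        using X(1) el(1) inv'(3) by blast+
      then have "sum (w l) (J - (J' - S) - X) = sum (w l) (J - J' - X) + sum (w l) S"
        using finJ finS by (simp add: sum.union_disjoint)
      moreover have "sum (w l) S < 2 * \<alpha>"
        using H SF el(2) False inv'(1) inv'(4)[of l] l el(1)
        by (intro sum_bundle_less[of J F S \<tau>]) auto
      ultimately show ?thesis
        using X unfolding count by (intro exI[of _ X]) (auto simp: algebra_simps)
    qed
  qed
  moreover have "\<exists>T. (A(i \<mapsto> S)) l = Some T \<and> set_value F (w l) T \<ge> \<alpha>"
    if "l \<in> I - (I' - {i})" for l
    using that inv'(5) el(4) by auto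
  moreover have "set_value F (w l) T < \<alpha>"
    if "l \<in> I' - {i}" "T \<subseteq> J' - S" "card T < \<tau>" for l T
    using that inv'(4) by blast
  ultimately show ?thesis
    using inv'(1-3) allocate(2) unfolding fdp_invariant_def by auto
qed

lemma fdp_outcome_invariant:
  assumes "hereditary_system J F" "finite I" "0 < \<alpha>"
    and "fdp_outcome I J F w \<alpha> A"
  obtains I' J' where "fdp_invariant I J F w \<alpha> (Suc (card J), I', J', A)"
proof -
  obtain I' J' where run: "(fdp_step F w \<alpha> (card J))\<^sup>*\<^sup>*
      (1, I, J, Map.empty) (Suc (card J), I', J', A)"
    using assms(4) by (auto simp: fdp_outcome_def)
  have "set_value F (w i) {} < \<alpha>" for i
  proof -
    obtain T where "T \<in> F" "T \<subseteq> {}" "sum (w i) T = set_value F (w i) {}"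
      using set_value_attained[OF hereditary_systemD(2,3)[OF assms(1)]] .
    then show ?thesis
      using assms(3) by simp
  qed
  \<comment> \<open>At \<tau> = 1 the smallness clause concerns \<open>card S = 0\<close>, which
    means the empty set because \<open>J\<close> is finite.\<close>
  moreover have "S = {}" if "S \<subseteq> J" "card S = 0" for S
    using that hereditary_systemD(1)[OF assms(1)] finite_subset[of S J] by simp
  ultimately have "fdp_invariant I J F w \<alpha> (1, I, J, Map.empty)"
    by (auto simp: fdp_invariant_def)
  with run have "fdp_invariant I J F w \<alpha> (Suc (card J), I', J', A)"
  proof (induction rule: rtranclp_induct)
    case (step s t)
    show ?case
      using fdp_invariant_step[OF assms(1,2) step.hyps(2) step.IH[OF step.prems]] .
  qed
  then show thesis
    by (rule that)
qed

section \<open>Counting parts against bundles\<close>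

text \<open>If every \<open>Q k\<close> kept less than 1/3, each would cost at least 2/3: those
  meeting \<open>X\<close> are charged to distinct elements of \<open>X\<close>, the others to the
  value lost outside \<open>X\<close>. The total would be at least \<open>2/3 * n\<close>.\<close>

lemma few_bundles_leave_valuable_part:
  fixes w :: "'a \<Rightarrow> real" and n :: nat
  assumes "finite J" "disjoint_family_on Q {..<n}"
    and Q: "\<And>k. k < n \<Longrightarrow> Q k \<subseteq> J" "\<And>k. k < n \<Longrightarrow> sum w (Q k) = 1"
    and nonneg: "\<And>j. j \<in> J \<Longrightarrow> 0 \<le> w j"
    and X: "X \<subseteq> J" "sum w (J - J' - X) + 2/3 * card X < 2/3 * n"
  obtains k where "k < n" "sum w (Q k \<inter> J') \<ge> 1/3"
proof (rule ccontr)
  assume contra: "\<not> thesis"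
  have less: "sum w (Q k \<inter> J') < 1/3" if "k < n" for k
    using contra \<open>\<And>k. k < n \<Longrightarrow> sum w (Q k \<inter> J') \<ge> 1/3 \<Longrightarrow> thesis\<close>[OF that]
    by linarith
  define K where "K = {k. k < n \<and> Q k \<inter> X = {}}"
  have finK: "finite K"
    by (simp add: K_def)
  have finQ: "finite (Q k)" if "k < n" for k
    using Q(1)[OF that] assms(1) finite_subset by blast
  have lost: "2/3 \<le> sum w (Q k - J')" if "k < n" for k
  proof -
    have "sum w (Q k) = sum w (Q k \<inter> J') + sum w (Q k - J')"
      using finQ[OF that] by (rule sum.Int_Diff)
    then show ?thesis
      using Q(2)[OF that] less[OF that] by simp
  qed
  have "n \<le> card K + card X"
  proof -
    have hit: "\<exists>x. x \<in> Q k \<inter> X" if "k \<in> {..<n} - K" for k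
      using that by (auto simp: K_def)
    then obtain f where f: "\<And>k. k \<in> {..<n} - K \<Longrightarrow> f k \<in> Q k \<inter> X"
      by metis
    have "inj_on f ({..<n} - K)"
    proof (rule inj_onI)
      fix k l assume kl: "k \<in> {..<n} - K" "l \<in> {..<n} - K" "f k = f l"
      then have "f k \<in> Q k \<inter> Q l"
        using f[of k] f[of l] by simp
      then show "k = l"
        using kl assms(2) unfolding disjoint_family_on_def by blast
    qed
    then have "card ({..<n} - K) \<le> card X"
      using f X(1) assms(1) by (intro card_inj_on_le) (auto intro: finite_subset)
    moreover have "card ({..<n} - K) = n - card K"
      by (subst card_Diff_subset) (auto simp: finK K_def)
    ultimately show ?thesis
      by simp
  qed
  moreover have "2/3 * card K \<le> sum w (J - J' - X)"
  proof -
    have "2/3 * card K \<le> (\<Sum>k\<in>K. sum w (Q k - J'))"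
      using sum_mono[of K "\<lambda>_. 2/3" "\<lambda>k. sum w (Q k - J')"] lost by (simp add: K_def)
    also have "\<dots> = sum w (\<Union>k\<in>K. Q k - J')"
      using finK finQ assms(2) unfolding disjoint_family_on_def
      by (intro sum.UNION_disjoint[symmetric]) (auto simp: K_def)
    \<comment> \<open>For \<open>k\<close> in \<open>K\<close> the set \<open>Q k\<close> avoids
      \<open>X\<close>, so the union lies in \<open>J - J' - X\<close>.\<close>
    also have "\<dots> \<le> sum w (J - J' - X)"
      using assms(1) Q(1) nonneg by (intro sum_mono2) (auto simp: K_def)
    finally show ?thesis .
  qed
  ultimately show False
    using X(2) by simp
qed

theorem theorem2:
  fixes I :: "'i set" and J :: "'a set" and F :: "'a set set" and n :: nat
    and v :: "'i \<Rightarrow> 'a \<Rightarrow> real" and P :: "'i \<Rightarrow> nat \<Rightarrow> 'a set"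
    and A :: "'i \<rightharpoonup> 'a set"
  assumes "hereditary_system J F"
    and "finite I" and "card I = n" and "n \<ge> 1"
    and "\<And>i j. i \<in> I \<Longrightarrow> j \<in> J \<Longrightarrow> v i j \<ge> 0"
    and "\<And>i. i \<in> I \<Longrightarrow> MMS J F n (v i) > 0"
    and "\<And>i. i \<in> I \<Longrightarrow> maximin_partition J F n (v i) (P i)"
    and "fdp_outcome I J F (\<lambda>i. normalized F n (v i) (P i)) (1/3) A"
  shows "\<forall>i\<in>I. \<exists>S. A i = Some S \<and> set_value F (v i) S \<ge> 1/3 * MMS J F n (v i)"
proof -
  note H = hereditary_systemD[OF assms(1)]
  define w where "w = (\<lambda>i. normalized F n (v i) (P i))"
  have nonneg: "0 \<le> w i j" if "i \<in> I" "j \<in> J" for i j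
    using normalized_bounds(1)[OF assms(7)[OF that(1)] assms(6)[OF that(1)] that(2)] assms(5) that
    by (simp add: w_def)
  obtain I' J' where inv: "fdp_invariant I J F w (1/3) (Suc (card J), I', J', A)"
    using fdp_outcome_invariant[OF assms(1,2) _ assms(8)[folded w_def]] by auto
  have "I' = {}"
  proof (rule ccontr)
    assume "I' \<noteq> {}"
    then obtain i where i: "i \<in> I'" "i \<in> I"
      using inv by (auto simp: fdp_invariant_def)
    have "J' \<subseteq> J" "finite I'"
      using inv assms(2) by (auto simp: fdp_invariant_def intro: finite_subset)
    \<comment> \<open>The final counter \<open>Suc (card J)\<close> exceeds the size of every subset
      of \<open>J'\<close>, so smallness holds without a size bound.\<close>
    have small: "set_value F (w i) S < 1/3" if "S \<subseteq> J'" for S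
    proof -
      have "card S \<le> card J"
        using that \<open>J' \<subseteq> J\<close> H(1) by (intro card_mono) auto
      then show ?thesis
        using inv i(1) that by (simp add: fdp_invariant_def)
    qed
    obtain X where X: "X \<subseteq> J - J'"
        "sum (w i) (J - J' - X) + 2/3 * card X \<le> 2/3 * (real n - real (card I'))"
      using inv i(1) assms(3) by (auto simp: fdp_invariant_def)
    \<comment> \<open>The waiting agent makes the bound strict: at most \<open>n - 1\<close> agents
      have been served.\<close>
    moreover have "0 < card I'"
      using i(1) \<open>finite I'\<close> by (auto simp: card_gt_0_iff)
    ultimately have Xn: "sum (w i) (J - J' - X) + 2/3 * card X < 2/3 * n"
      by simp
    have "\<exists>Q. Q \<in> F \<and> Q \<subseteq> P i k \<and> sum (w i) Q = 1" if "k < n" for k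
      using normalized_part_attains_one[OF assms(1) assms(7)[OF i(2)] assms(6)[OF i(2)] that]
      unfolding w_def by blast
    then obtain Q where Q: "Q k \<in> F" "Q k \<subseteq> P i k" "sum (w i) (Q k) = 1" if "k < n" for k
      by metis
    have "disjoint_family_on (P i) {..<n}"
      using assms(7)[OF i(2)] by (simp add: maximin_partition_def partitions_into_def)
    then have "disjoint_family_on Q {..<n}"
      using Q(2) unfolding disjoint_family_on_def by (meson disjoint_iff lessThan_iff subsetD)
    moreover have "X \<subseteq> J"
      using X(1) by blast
    ultimately obtain k where k: "k < n" "sum (w i) (Q k \<inter> J') \<ge> 1/3"
      using few_bundles_leave_valuable_part[of J Q n "w i" X J'] H(1) H(4)[OF Q(1)] Q(3)
        nonneg[OF i(2)] Xn by metis
    \<comment> \<open>What remains of \<open>Q k\<close> is feasible by heredity, so its additive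
      value of at least 1/3 contradicts \<open>small\<close>.\<close>
    have "sum (w i) (Q k \<inter> J') \<le> set_value F (w i) (Q k \<inter> J')"
      using H(5)[OF Q(1)[OF k(1)]] by (intro sum_le_set_value[OF H(2)]) auto
    then show False
      using small[of "Q k \<inter> J'"] k(2) by simp
  qed
  show ?thesis
  proof
    fix i assume i: "i \<in> I"
    then obtain S where S: "A i = Some S" "set_value F (w i) S \<ge> 1/3"
      using inv \<open>I' = {}\<close> by (auto simp: fdp_invariant_def)
    have "1/3 * MMS J F n (v i) \<le> MMS J F n (v i) * set_value F (w i) S"
      using S(2) assms(6)[OF i] by simp
    also have "\<dots> \<le> set_value F (v i) S"
      unfolding w_def
      using normalized_set_value_le[OF assms(1) assms(7)[OF i] assms(6)[OF i] assms(5)[OF i]] .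
    finally show "\<exists>S. A i = Some S \<and> set_value F (v i) S \<ge> 1/3 * MMS J F n (v i)"
      using S(1) by blast
  qed
qed

end
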